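(* For any $\widehat H_\diamond\in\mathcal F_\diamond$ the limit $\lim_{\delta\to+\infty}\phi^\delta(\widehat H_\diamond)$ exists (in the product topology on $\mathcal F_\diamond$) and lies in $\mathcal N_\diamond$.
   Context: Let $n\ge1$ and let $\omega\in\mathbb R^n$ be nonresonant: $\langle q,\omega\rangle\ne0$ for all $q\in\mathbb Z^n\setminus\{0\}$. Let $z=(z_1,\dots,z_n)$, $\overline z=(\overline z_1,\dots,\overline z_n)$ be independent complex variables (the bar is not complex conjugation), $\mathbf z=(z,\overline z)$. For $\mathbf k=(k,\overline k)\in\mathbb Z_+^{2n}$ put $\mathbf k'=\overline k-k\in\mathbb Z^n$, let $|\mathbf k|$ be the sum of all components, $\mathbf z^{\mathbf k}=z^k\overline z^{\overline k}$. Let $\mathcal F_\diamond$ be the space of formal power series $H_\diamond=\sum_{|\mathbf k|\ge3}H_{\mathbf k}\mathbf z^{\mathbf k}$ with complex coefficients, with the product topology (convergence of each coefficient), and $\mathcal N_\diamond=\{H_\diamond\in\mathcal F_\diamond:H_{\mathbf k}\ne0\text{ implies }\mathbf k'=0\}$. Put $H_2=\sum_j\omega_jz_j\overline z_j$, $\{F,G\}=i\sum_{j=1}^n(\partial_{\overline z_j}F\,\partial_{z_j}G-\partial_{z_j}F\,\partial_{\overline z_j}G)$, and $\xi H_\diamond=-i\sum_{|\mathbf k|\ge3}\sigma_{\mathbf k'}H_{\mathbf k}\mathbf z^{\mathbf k}$, where $\sigma_q=\operatorname{sign}\langle\omega,q\rangle$ for $q\in\mathbb Z^n$ ($\sigma_0=0$).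 For $\widehat H_\diamond\in\mathcal F_\diamond$ and $\delta\ge0$, $\phi^\delta(\widehat H_\diamond)$ denotes the value at $\delta$ of the (unique, existing for all $\delta\ge0$) solution in $\mathcal F_\diamond$ of $\partial_\delta H_\diamond=-\{\xi H_\diamond,H_2+H_\diamond\}$, $H_\diamond|_{\delta=0}=\widehat H_\diamond$, understood as an infinite ODE system for the coefficients $H_{\mathbf k}(\delta)$. *)

theory Defs
  imports "HOL-Analysis.Analysis"
begin

text \<open>A multi-index is a pair (k, kbar); the dimension n is the cardinality of the finite type
  variable, so n is arbitrary and at least 1.  Formal power series in the 2n independent variables
  z, zbar are coefficient families indexed by multi-indices.  On this function type the
  topology of the library is the product topology, i.e. coefficientwise convergence.\<close>

type_synonym 'n mindex = "(nat ^ 'n) \<times> (nat ^ 'n)"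
type_synonym 'n mfps = "'n mindex \<Rightarrow> complex"

definition mdeg :: "'n::finite mindex \<Rightarrow> nat" where
  "mdeg k = (\<Sum>j\<in>UNIV. fst k $ j) + (\<Sum>j\<in>UNIV. snd k $ j)"

text \<open>k' = kbar - k\<close>

definition mdiff :: "'n::finite mindex \<Rightarrow> int ^ 'n" where
  "mdiff k = (\<chi> j. int (snd k $ j) - int (fst k $ j))"

definition freq :: "real ^ 'n::finite \<Rightarrow> int ^ 'n \<Rightarrow> real" where
  "freq \<omega> q = \<omega> \<bullet> (\<chi> j. real_of_int (q $ j))"

definition nonresonant :: "real ^ 'n::finite \<Rightarrow> bool" where
  "nonresonant \<omega> \<longleftrightarrow> (\<forall>q. q \<noteq> 0 \<longrightarrow> freq \<omega> q \<noteq> 0)"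

definition F_diamond :: "'n::finite mfps set" where
  "F_diamond = {H. \<forall>k. H k \<noteq> 0 \<longrightarrow> 3 \<le> mdeg k}"

definition N_diamond :: "'n::finite mfps set" where
  "N_diamond = {H \<in> F_diamond. \<forall>k. H k \<noteq> 0 \<longrightarrow> mdiff k = 0}"

definition mfps_mult :: "'n::finite mfps \<Rightarrow> 'n mfps \<Rightarrow> 'n mfps" where
  "mfps_mult F G k = (\<Sum>(a, b)\<in>{(a, b). a + b = k}. F a * G b)"

text \<open>The sum above is genuine: its index set is finite.\<close>

lemma finite_mindex_splittings: "finite {(a, b). a + b = (k :: 'n::finite mindex)}"
proof -
  have fin: "finite {v :: nat ^ 'n. \<forall>j. v $ j \<le> w $ j}" for w
  proof -
    have "finite (vec_lambda ` (\<Pi>\<^sub>E j\<in>UNIV. {..w $ j}))"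
      by (intro finite_imageI finite_PiE) auto
    moreover have "{v :: nat ^ 'n. \<forall>j. v $ j \<le> w $ j} \<subseteq> vec_lambda ` (\<Pi>\<^sub>E j\<in>UNIV. {..w $ j})"
    proof
      fix v :: "nat ^ 'n" assume "v \<in> {v. \<forall>j. v $ j \<le> w $ j}"
      then have "vec_nth v \<in> (\<Pi>\<^sub>E j\<in>UNIV. {..w $ j})" by auto
      then have "vec_lambda (vec_nth v) \<in> vec_lambda ` (\<Pi>\<^sub>E j\<in>UNIV. {..w $ j})"
        by (rule imageI)
      then show "v \<in> vec_lambda ` (\<Pi>\<^sub>E j\<in>UNIV. {..w $ j})" by simp
    qed
    ultimately show ?thesis by (rule finite_subset[rotated])
  qed
  let ?B = "{v :: nat ^ 'n. \<forall>j. v $ j \<le> fst k $ j} \<times> {v :: nat ^ 'n. \<forall>j. v $ j \<le> snd k $ j}"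
  have "{(a, b). a + b = k} \<subseteq> ?B \<times> ?B" by auto
  then show ?thesis
    using fin by (meson finite_SigmaI finite_subset)
qed

text \<open>Formal partial derivatives with respect to z_j and zbar_j\<close>

definition deriv_z :: "'n::finite \<Rightarrow> 'n mfps \<Rightarrow> 'n mfps" where
  "deriv_z j F k = of_nat (Suc (fst k $ j)) * F (k + (axis j 1, 0))"

definition deriv_zbar :: "'n::finite \<Rightarrow> 'n mfps \<Rightarrow> 'n mfps" where
  "deriv_zbar j F k = of_nat (Suc (snd k $ j)) * F (k + (0, axis j 1))"

definition poisson :: "'n::finite mfps \<Rightarrow> 'n mfps \<Rightarrow> 'n mfps" where
  "poisson F G k = \<i> * (\<Sum>j\<in>UNIV. mfps_mult (deriv_zbar j F) (deriv_z j G) k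
                               - mfps_mult (deriv_z j F) (deriv_zbar j G) k)"

definition H2 :: "real ^ 'n::finite \<Rightarrow> 'n mfps" where
  "H2 \<omega> k = (\<Sum>j\<in>UNIV. if k = (axis j 1, axis j 1) then complex_of_real (\<omega> $ j) else 0)"

definition xi :: "real ^ 'n::finite \<Rightarrow> 'n mfps \<Rightarrow> 'n mfps" where
  "xi \<omega> H k = (if 3 \<le> mdeg k
                then - \<i> * complex_of_real (sgn (freq \<omega> (mdiff k))) * H k else 0)"

text \<open>Solutions, on all of [0, infinity), of the coefficientwise ODE system with initial value
  \<^term>\<open>Hhat\<close>; the derivative at 0 is one-sided.\<close>

definition is_solution :: "real ^ 'n::finite \<Rightarrow> 'n mfps \<Rightarrow> (real \<Rightarrow> 'n mfps) \<Rightarrow> bool" where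
  "is_solution \<omega> Hhat H \<longleftrightarrow>
     H 0 = Hhat \<and>
     (\<forall>\<delta>\<ge>0. H \<delta> \<in> F_diamond) \<and>
     (\<forall>\<delta>\<ge>0. \<forall>k. ((\<lambda>s. H s k) has_vector_derivative
        - poisson (xi \<omega> (H \<delta>)) (\<lambda>l. H2 \<omega> l + H \<delta> l) k) (at \<delta> within {0..}))"

text \<open>The value is described, rather than the solution, because solutions as functions on the
  reals are arbitrary at negative times.\<close>

definition flow :: "real ^ 'n::finite \<Rightarrow> real \<Rightarrow> 'n mfps \<Rightarrow> 'n mfps" where
  "flow \<omega> \<delta> Hhat = (THE X. \<exists>H. is_solution \<omega> Hhat H \<and> X = H \<delta>)"

end

theory Submission
  imports Defs
begin

text \<open>In coordinates the flow reads $\partial_\delta H_k = -|\langle\omega,k'\rangle| H_k + f_k(H)$,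
  where $f_k$ is quadratic and, since all series start in degree 3, involves only coefficients of
  degree less than $|k|$.  This triangular system is solved uniquely by induction on the degree.
  The same induction shows that $H_k$ decays exponentially if $k' \neq 0$ and converges if
  $k' = 0$: each summand of $f_k$ contains a factor $\sigma_{p'} H_p$, which vanishes for $p' = 0$
  and decays for $p' \neq 0$, while the other factor is bounded; hence $f_k$ decays
  exponentially.\<close>

section \<open>Scalar linear differential equations on the half-line\<close>

lemma has_vector_derivative_half_line_zero_imp_constant:
  fixes y :: "real \<Rightarrow> 'a::real_normed_vector"
  assumes "\<And>t. 0 \<le> t \<Longrightarrow> (y has_vector_derivative 0) (at t within {0..})" and "0 \<le> t"
  shows "y t = y 0"
proof -
  have "\<exists>c. \<forall>t\<in>{0::real..}. y t = c"
    by (rule has_derivative_zero_constant) (use assms in \<open>auto simp: has_vector_derivative_def\<close>)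
  then show ?thesis
    using assms(2) by force
qed

lemma has_vector_derivative_exp_scaleR:
  fixes x :: "real \<Rightarrow> 'a::real_normed_vector"
  assumes "(x has_vector_derivative x') (at t within S)"
  shows "((\<lambda>t. exp (c * t) *\<^sub>R x t) has_vector_derivative exp (c * t) *\<^sub>R (c *\<^sub>R x t + x')) (at t within S)"
  by (rule has_vector_derivative_eq_rhs[OF has_vector_derivative_scaleR[OF _ assms]])
     (auto intro!: derivative_eq_intros simp: algebra_simps)

text \<open>The integrating factor \<open>exp (c * t)\<close> turns the solution into a constant,
  whatever the sign of \<open>c\<close>.\<close>

lemma homogeneous_linear_ode_zero:
  fixes x :: "real \<Rightarrow> 'a::real_normed_vector"
  assumes "\<And>t. 0 \<le> t \<Longrightarrow> (x has_vector_derivative - c *\<^sub>R x t) (at t within {0..})"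
    and "x 0 = 0" and "0 \<le> t"
  shows "x t = 0"
proof -
  have "((\<lambda>t. exp (c * t) *\<^sub>R x t) has_vector_derivative 0) (at t within {0..})" if "0 \<le> t" for t
    using has_vector_derivative_exp_scaleR[OF assms(1)[OF that], of c] by simp
  from has_vector_derivative_half_line_zero_imp_constant[OF this \<open>0 \<le> t\<close>] assms(2)
  show ?thesis by simp
qed

lemma integral_has_vector_derivative_half_line:
  fixes g :: "real \<Rightarrow> 'a::banach"
  assumes "continuous_on {0..} g" and "0 \<le> t"
  shows "((\<lambda>u. integral {0..u} g) has_vector_derivative g t) (at t within {0..})"
proof -
  have "((\<lambda>u. integral {0..u} g) has_vector_derivative g t) (at t within {0..t + 1})"
    by (rule integral_has_vector_derivative) (use assms in \<open>auto intro: continuous_on_subset\<close>)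
  \<comment> \<open>The fundamental theorem is available on compact intervals; extending the
    interval past \<open>t\<close> makes its filter at \<open>t\<close> agree with that of the
    half-line.\<close>
  moreover have "at t within {0..t + 1} = at t within {0..}"
    by (rule at_within_nhd[of _ "{..<t + 1}"]) auto
  ultimately show ?thesis by simp
qed

text \<open>Variation of constants: differentiating the prefactor gives the linear term, and
  differentiating the integral gives \<open>g t\<close> because the two exponentials cancel.\<close>

lemma duhamel_has_vector_derivative:
  fixes g :: "real \<Rightarrow> 'a::banach" and x\<^sub>0 :: 'a and c :: real
  assumes "continuous_on {0..} g" and "0 \<le> t"
  defines "x \<equiv> \<lambda>t. exp (- c * t) *\<^sub>R (x\<^sub>0 + integral {0..t} (\<lambda>s. exp (c * s) *\<^sub>R g s))"
  shows "(x has_vector_derivative - c *\<^sub>R x t + g t) (at t within {0..})"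
proof -
  have "continuous_on {0..} (\<lambda>s. exp (c * s) *\<^sub>R g s)"
    by (intro continuous_intros assms)
  from integral_has_vector_derivative_half_line[OF this \<open>0 \<le> t\<close>]
  have *: "((\<lambda>t. x\<^sub>0 + integral {0..t} (\<lambda>s. exp (c * s) *\<^sub>R g s)) has_vector_derivative
      0 + exp (c * t) *\<^sub>R g t) (at t within {0..})"
    by (intro derivative_intros)
  show ?thesis
    unfolding x_def
    by (rule has_vector_derivative_eq_rhs[OF has_vector_derivative_exp_scaleR[OF *]])
       (simp add: algebra_simps mult_exp_exp)
qed

section \<open>Exponential decay and boundedness in forward time\<close>

text \<open>The rate is existential because it may shrink from one degree to the next. Negative
  times are excluded since solutions are arbitrary there.\<close>

definition exp_decay :: "(real \<Rightarrow> 'a::real_normed_vector) \<Rightarrow> bool" where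
  "exp_decay g \<longleftrightarrow> (\<exists>C \<mu>. 0 < \<mu> \<and> (\<forall>t\<ge>0. norm (g t) \<le> C * exp (- \<mu> * t)))"

definition bounded_forward :: "(real \<Rightarrow> 'a::real_normed_vector) \<Rightarrow> bool" where
  "bounded_forward g \<longleftrightarrow> (\<exists>C. \<forall>t\<ge>0. norm (g t) \<le> C)"

lemma exp_decayI:
  "0 < \<mu> \<Longrightarrow> (\<And>t. 0 \<le> t \<Longrightarrow> norm (g t) \<le> C * exp (- \<mu> * t)) \<Longrightarrow> exp_decay g"
  unfolding exp_decay_def by blast

text \<open>Lowering the rate only weakens the bound. The cap \<open>\<nu>\<close> serves to give
  two functions comparable rates, or to keep the rate of a forcing term below that of the
  equation.\<close>

lemma exp_decayE_le:
  assumes "exp_decay g" and "0 < \<nu>"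
  obtains C \<mu> where "0 \<le> C" "0 < \<mu>" "\<mu> \<le> \<nu>" "\<And>t. 0 \<le> t \<Longrightarrow> norm (g t) \<le> C * exp (- \<mu> * t)"
proof -
  obtain C \<mu> where \<mu>: "0 < \<mu>" and C: "\<And>t. 0 \<le> t \<Longrightarrow> norm (g t) \<le> C * exp (- \<mu> * t)"
    using assms(1) unfolding exp_decay_def by blast
  have C0: "0 \<le> C"
    using order_trans[OF norm_ge_zero C[of 0]] by simp
  have "norm (g t) \<le> C * exp (- min \<mu> \<nu> * t)" if "0 \<le> t" for t
    by (rule order_trans[OF C[OF that]]) (use C0 that in \<open>auto intro!: mult_left_mono mult_right_mono\<close>)
  then show ?thesis
    using that[of C "min \<mu> \<nu>"] C0 \<mu> assms(2) by auto
qed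

lemma exp_decayE:
  assumes "exp_decay g"
  obtains C \<mu> where "0 \<le> C" "0 < \<mu>" "\<And>t. 0 \<le> t \<Longrightarrow> norm (g t) \<le> C * exp (- \<mu> * t)"
  using exp_decayE_le[OF assms zero_less_one] by metis

lemma exp_decay_zero [simp]: "exp_decay (\<lambda>t. 0)"
  by (rule exp_decayI[of 1 _ 0]) auto

lemma exp_decay_add:
  assumes "exp_decay f" and "exp_decay g"
  shows "exp_decay (\<lambda>t. f t + g t)"
proof -
  obtain C \<mu> where 1: "0 \<le> C" "0 < \<mu>" "\<And>t. 0 \<le> t \<Longrightarrow> norm (f t) \<le> C * exp (- \<mu> * t)"
    using exp_decayE[OF assms(1)] by blast
  obtain D \<nu> where 2: "0 \<le> D" "0 < \<nu>" "\<nu> \<le> \<mu>" "\<And>t. 0 \<le> t \<Longrightarrow> norm (g t) \<le> D * exp (- \<nu> * t)"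
    using exp_decayE_le[OF assms(2) 1(2)] by auto
  show ?thesis
  proof (rule exp_decayI[OF 2(2)])
    fix t :: real assume t: "0 \<le> t"
    have "norm (f t + g t) \<le> C * exp (- \<mu> * t) + D * exp (- \<nu> * t)"
      using norm_triangle_ineq[of "f t" "g t"] 1(3)[OF t] 2(4)[OF t] by linarith
    also have "C * exp (- \<mu> * t) \<le> C * exp (- \<nu> * t)"
      using 1 2 t by (auto intro!: mult_left_mono mult_right_mono)
    finally show "norm (f t + g t) \<le> (C + D) * exp (- \<nu> * t)"
      by (simp add: algebra_simps)
  qed
qed

lemma exp_decay_mult_bounded:
  fixes f g :: "real \<Rightarrow> 'a::real_normed_algebra"
  assumes "exp_decay f" and "bounded_forward g"
  shows "exp_decay (\<lambda>t. f t * g t)"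
proof -
  obtain C \<mu> where 1: "0 \<le> C" "0 < \<mu>" "\<And>t. 0 \<le> t \<Longrightarrow> norm (f t) \<le> C * exp (- \<mu> * t)"
    using exp_decayE[OF assms(1)] by blast
  obtain D where 2: "\<And>t. 0 \<le> t \<Longrightarrow> norm (g t) \<le> D"
    using assms(2) unfolding bounded_forward_def by blast
  show ?thesis
  proof (rule exp_decayI[OF 1(2)])
    fix t :: real assume t: "0 \<le> t"
    have "norm (f t * g t) \<le> norm (f t) * norm (g t)" by (rule norm_mult_ineq)
    also have "\<dots> \<le> (C * exp (- \<mu> * t)) * D"
      by (rule mult_mono) (use 1 2 t in auto)
    finally show "norm (f t * g t) \<le> (C * D) * exp (- \<mu> * t)" by (simp add: algebra_simps)
  qed
qed

lemma exp_decay_cmult: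
  fixes f :: "real \<Rightarrow> 'a::real_normed_field"
  assumes "exp_decay f"
  shows "exp_decay (\<lambda>t. c * f t)"
  using exp_decay_mult_bounded[OF assms, of "\<lambda>_. c"]
  by (auto simp: bounded_forward_def mult.commute)

lemma exp_decay_diff:
  assumes "exp_decay f" and "exp_decay g"
  shows "exp_decay (\<lambda>t. f t - g t)"
  using exp_decay_add[OF assms(1), of "\<lambda>t. - g t"] assms(2) by (simp add: exp_decay_def)

lemma exp_decay_sum:
  "(\<And>i. i \<in> I \<Longrightarrow> exp_decay (f i)) \<Longrightarrow> exp_decay (\<lambda>t. \<Sum>i\<in>I. f i t)"
  by (induction I rule: infinite_finite_induct) (auto intro: exp_decay_add)

lemma exp_decay_imp_bounded_forward:
  assumes "exp_decay g"
  shows "bounded_forward g"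
proof -
  obtain C \<mu> where 1: "0 \<le> C" "0 < \<mu>" "\<And>t. 0 \<le> t \<Longrightarrow> norm (g t) \<le> C * exp (- \<mu> * t)"
    using exp_decayE[OF assms] by blast
  have "norm (g t) \<le> C" if "0 \<le> t" for t
    by (rule order_trans[OF 1(3)[OF that]]) (use 1 that in \<open>auto intro!: mult_left_le\<close>)
  then show ?thesis unfolding bounded_forward_def by blast
qed

lemma exp_decay_profile_tendsto_zero:
  fixes \<mu> :: real
  assumes "0 < \<mu>"
  shows "((\<lambda>t. C * exp (- \<mu> * t)) \<longlongrightarrow> 0) at_top"
proof -
  have "filterlim (\<lambda>t. - \<mu> * t) at_bot at_top"
    by (rule filterlim_tendsto_neg_mult_at_bot[OF tendsto_const _ filterlim_ident]) (use assms in auto)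
  then show ?thesis
    by (intro tendsto_mult_right_zero filterlim_compose[OF exp_at_bot])
qed

lemma exp_decay_imp_tendsto_zero:
  assumes "exp_decay g"
  shows "(g \<longlongrightarrow> 0) at_top"
proof -
  obtain C \<mu> where 1: "0 \<le> C" "0 < \<mu>" "\<And>t. 0 \<le> t \<Longrightarrow> norm (g t) \<le> C * exp (- \<mu> * t)"
    using exp_decayE[OF assms] by blast
  have "((\<lambda>t. C * exp (- \<mu> * t)) \<longlongrightarrow> 0) at_top"
    by (rule exp_decay_profile_tendsto_zero[OF 1(2)])
  then show ?thesis
    by (rule Lim_null_comparison[rotated])
       (use 1(3) in \<open>auto intro!: eventually_mono[OF eventually_ge_at_top[of 0]]\<close>)
qed

section \<open>Long-time behaviour under decaying forcing\<close>

text \<open>A mean value inequality with majorant \<open>\<phi>\<close>; it replaces integration of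
  the bound on the derivative.\<close>

lemma has_vector_derivative_half_line_bound:
  fixes y :: "real \<Rightarrow> 'a::real_normed_vector" and \<phi> :: "real \<Rightarrow> real"
  assumes y: "\<And>t. 0 \<le> t \<Longrightarrow> (y has_vector_derivative y' t) (at t within {0..})"
    and \<phi>: "\<And>t. (\<phi> has_real_derivative \<phi>' t) (at t)"
    and le: "\<And>t. 0 \<le> t \<Longrightarrow> norm (y' t) \<le> \<phi>' t"
    and ab: "0 \<le> a" "a \<le> b"
  shows "norm (y b - y a) \<le> \<phi> b - \<phi> a"
proof (cases "a = b")
  case False
  show ?thesis
  proof (rule differentiable_bound_general)
    show "a < b" using ab False by simp
    have "continuous_on {0..} y"
      using y by (auto intro!: continuous_on_vector_derivative)
    then show "continuous_on {a..b} y" by (rule continuous_on_subset) (use ab in auto)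
    show "continuous_on {a..b} \<phi>" 
      using \<phi> by (meson DERIV_isCont continuous_at_imp_continuous_on)
    fix t assume t: "a < t" "t < b"
    have "at t within {0..} = at t"
      by (rule at_within_interior) (use t ab in auto)
    then show "(y has_vector_derivative y' t) (at t)"
      using y[of t] t ab by simp
    show "(\<phi> has_vector_derivative \<phi>' t) (at t)"
      using \<phi> by (simp add: has_real_derivative_iff_has_vector_derivative)
    show "norm (y' t) \<le> \<phi>' t" using le t ab by simp
  qed
qed simp

text \<open>After multiplication by \<open>exp (c * t)\<close> the derivative is at most
  \<open>C * exp ((c - \<mu>) * t)\<close>. Integrating and multiplying back by
  \<open>exp (- c * t)\<close> leaves decay at rate \<open>\<mu>\<close>.\<close>

lemma linear_ode_exp_decay:
  fixes x :: "real \<Rightarrow> 'a::real_normed_vector"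
  assumes x: "\<And>t. 0 \<le> t \<Longrightarrow> (x has_vector_derivative - c *\<^sub>R x t + g t) (at t within {0..})"
    and "0 < c" and "exp_decay g"
  shows "exp_decay x"
proof -
  \<comment> \<open>The cap \<open>c / 2\<close> keeps \<open>d = c - \<mu>\<close> positive and so
    avoids the case of equal rates, where integration would produce a factor
    \<open>t\<close>.\<close>
  obtain C \<mu> where 1: "0 \<le> C" "0 < \<mu>" "\<mu> \<le> c / 2"
      "\<And>t. 0 \<le> t \<Longrightarrow> norm (g t) \<le> C * exp (- \<mu> * t)"
    using exp_decayE_le[OF assms(3), of "c / 2"] assms(2) by auto
  define d where "d = c - \<mu>"
  have d: "0 < d" using 1 assms(2) by (simp add: d_def)
  show ?thesis
  proof (rule exp_decayI[OF 1(2)])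
    fix t :: real assume t: "0 \<le> t"
    have "norm (exp (c * t) *\<^sub>R x t - exp (c * 0) *\<^sub>R x 0) \<le> C / d * exp (d * t) - C / d * exp (d * 0)"
    proof (rule has_vector_derivative_half_line_bound
        [where y = "\<lambda>t. exp (c * t) *\<^sub>R x t" and y' = "\<lambda>t. exp (c * t) *\<^sub>R g t" and \<phi>' = "\<lambda>t. C * exp (d * t)"])
      fix t :: real assume t: "0 \<le> t"
      show "((\<lambda>t. exp (c * t) *\<^sub>R x t) has_vector_derivative exp (c * t) *\<^sub>R g t) (at t within {0..})"
        using has_vector_derivative_exp_scaleR[OF x[OF t], of c] by simp
      have "norm (exp (c * t) *\<^sub>R g t) \<le> exp (c * t) * (C * exp (- \<mu> * t))"
        using 1(4)[OF t] by simp
      also have "\<dots> = C * exp (d * t)" by (simp add: d_def mult_exp_exp algebra_simps)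
      finally show "norm (exp (c * t) *\<^sub>R g t) \<le> C * exp (d * t)" .
    qed (use t d in \<open>auto intro!: derivative_eq_intros\<close>)
    moreover have "0 \<le> C / d" using 1 d by simp
    ultimately have "norm (exp (c * t) *\<^sub>R x t) \<le> norm (x 0) + C / d * exp (d * t)"
      using norm_triangle_ineq2[of "exp (c * t) *\<^sub>R x t" "x 0"] by simp
    \<comment> \<open>As \<open>d\<close> and \<open>t\<close> are nonnegative, the initial value is
      absorbed into the growing exponential.\<close>
    also have "norm (x 0) \<le> norm (x 0) * exp (d * t)"
      using d t by (simp add: mult_le_cancel_left1)
    finally have *: "exp (c * t) * norm (x t) \<le> (norm (x 0) + C / d) * exp (d * t)"
      by (simp add: algebra_simps)
    have "norm (x t) = exp (- c * t) * (exp (c * t) * norm (x t))"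
      by (simp add: mult_exp_exp flip: mult.assoc)
    also have "\<dots> \<le> exp (- c * t) * ((norm (x 0) + C / d) * exp (d * t))"
      using * by (intro mult_left_mono) auto
    also have "\<dots> = (norm (x 0) + C / d) * exp (- \<mu> * t)"
      by (simp add: d_def mult_exp_exp algebra_simps)
    finally show "norm (x t) \<le> (norm (x 0) + C / d) * exp (- \<mu> * t)" .
  qed
qed

text \<open>The derivative is integrable at infinity: its majorant has antiderivative
  \<open>- C / \<mu> * exp (- \<mu> * t)\<close>, so increments beyond time \<open>s\<close> are of
  order \<open>exp (- \<mu> * s)\<close>.\<close>

lemma exp_decay_derivative_imp_convergent:
  fixes x :: "real \<Rightarrow> 'a::banach"
  assumes x: "\<And>t. 0 \<le> t \<Longrightarrow> (x has_vector_derivative g t) (at t within {0..})"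
    and "exp_decay g"
  obtains l where "(x \<longlongrightarrow> l) at_top" and "bounded_forward x"
proof -
  obtain C \<mu> where 1: "0 \<le> C" "0 < \<mu>" "\<And>t. 0 \<le> t \<Longrightarrow> norm (g t) \<le> C * exp (- \<mu> * t)"
    using exp_decayE[OF assms(2)] by blast
  have bd: "norm (x t - x s) \<le> C / \<mu> * exp (- \<mu> * s)" if "0 \<le> s" "s \<le> t" for s t
  proof -
    have "norm (x t - x s) \<le> - C / \<mu> * exp (- \<mu> * t) - (- C / \<mu> * exp (- \<mu> * s))"
      by (rule has_vector_derivative_half_line_bound[where \<phi>' = "\<lambda>t. C * exp (- \<mu> * t)", OF x])
         (use 1 that in \<open>auto intro!: derivative_eq_intros\<close>)
    also have "\<dots> \<le> C / \<mu> * exp (- \<mu> * s)" using 1 by simp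
    finally show ?thesis .
  qed
  have lim0: "((\<lambda>s. C / \<mu> * exp (- \<mu> * s)) \<longlongrightarrow> 0) at_top"
    by (rule exp_decay_profile_tendsto_zero[OF 1(2)])
  have "Cauchy (\<lambda>n. x (real n))"
  proof (rule metric_CauchyI)
    fix e :: real assume "0 < e"
    then have "\<forall>\<^sub>F s in at_top. C / \<mu> * exp (- \<mu> * s) < e / 2"
      using order_tendstoD(2)[OF lim0, of "e / 2"] by simp
    then obtain N where N: "\<And>s. N \<le> s \<Longrightarrow> C / \<mu> * exp (- \<mu> * s) < e / 2"
      unfolding eventually_at_top_linorder by auto
    define M where "M = nat \<lceil>N\<rceil>"
    have M: "C / \<mu> * exp (- \<mu> * real M) < e / 2"
      by (rule N) (simp add: M_def real_nat_ceiling_ge)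
    have "dist (x (real n)) (x (real M)) < e / 2" if "M \<le> n" for n
      unfolding dist_norm by (rule order.strict_trans1[OF bd M]) (use that in auto)
    then show "\<exists>M. \<forall>m\<ge>M. \<forall>n\<ge>M. dist (x (real m)) (x (real n)) < e"
      using dist_triangle_half_l[of _ _ e] by (metis dist_commute)
  qed
  then obtain l where l: "(\<lambda>n. x (real n)) \<longlonglongrightarrow> l"
    using Cauchy_convergent_iff convergent_def by blast
  \<comment> \<open>The limit was found along integer times. Letting \<open>n\<close> tend to
    infinity in the increment bound for fixed \<open>s\<close> extends convergence to real
    times.\<close>
  have "norm (l - x s) \<le> C / \<mu> * exp (- \<mu> * s)" if "0 \<le> s" for s
  proof (rule tendsto_upperbound)
    show "(\<lambda>n. norm (x (real n) - x s)) \<longlonglongrightarrow> norm (l - x s)"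
      by (intro tendsto_intros l)
    have "\<forall>\<^sub>F n in sequentially. s \<le> real n"
      using filterlim_real_sequentially by (simp add: filterlim_at_top)
    then show "\<forall>\<^sub>F n in sequentially. norm (x (real n) - x s) \<le> C / \<mu> * exp (- \<mu> * s)"
      by eventually_elim (use bd that in auto)
  qed simp
  then have "\<forall>\<^sub>F s in at_top. norm (x s - l) \<le> C / \<mu> * exp (- \<mu> * s)"
    by (auto intro!: eventually_mono[OF eventually_ge_at_top[of 0]] simp: norm_minus_commute)
  then have "((\<lambda>s. x s - l) \<longlongrightarrow> 0) at_top"
    by (rule Lim_null_comparison[OF _ lim0])
  then have "(x \<longlongrightarrow> l) at_top" by (simp add: LIM_zero_iff)
  moreover have "norm (x t) \<le> C / \<mu> + norm (x 0)" if "0 \<le> t" for t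
    using bd[of 0 t] that norm_triangle_ineq2[of "x t" "x 0"] by simp
  then have "bounded_forward x" unfolding bounded_forward_def by blast
  ultimately show ?thesis by (rule that)
qed

section \<open>Triangular systems of differential equations\<close>

lemma tendsto_coordinatewise:
  fixes f :: "'b \<Rightarrow> 'k \<Rightarrow> 'a::topological_space"
  assumes "\<And>k. ((\<lambda>t. f t k) \<longlongrightarrow> l k) F"
  shows "(f \<longlongrightarrow> l) F"
  using assms
  by (simp add: limitin_componentwise flip: limitin_canonical_iff euclidean_product_topology)

text \<open>Models the system x_k' = - c_k x_k + f_k(x). Once the lower degrees are solved, the
  equation for x_k is a linear one with known forcing. Continuity in the product topology makes this
  forcing continuous in time.\<close>

locale triangular_ode =
  fixes deg :: "'k \<Rightarrow> nat" and c :: "'k \<Rightarrow> real" and f :: "('k \<Rightarrow> 'a::banach) \<Rightarrow> 'k \<Rightarrow> 'a"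
  assumes triangular: "(\<And>l. deg l < deg k \<Longrightarrow> x l = y l) \<Longrightarrow> f x k = f y k"
    and cont: "continuous_on UNIV (\<lambda>x. f x k)"
begin

definition solves :: "(real \<Rightarrow> 'k \<Rightarrow> 'a) \<Rightarrow> bool" where
  "solves x \<longleftrightarrow> (\<forall>t\<ge>0. \<forall>k. ((\<lambda>s. x s k) has_vector_derivative
     - c k *\<^sub>R x t k + f (x t) k) (at t within {0..}))"

lemma solvesD:
  "solves x \<Longrightarrow> 0 \<le> t \<Longrightarrow>
    ((\<lambda>s. x s k) has_vector_derivative - c k *\<^sub>R x t k + f (x t) k) (at t within {0..})"
  by (simp add: solves_def)

text \<open>By induction on the degree the forcing terms of both solutions agree, so their
  difference solves a homogeneous equation with zero initial value.\<close>

lemma solves_unique: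
  assumes "solves x" "solves y" "x 0 = y 0" "0 \<le> t"
  shows "x t = y t"
proof -
  have "\<forall>t\<ge>0. x t k = y t k" for k
  proof (induction "deg k" arbitrary: k rule: less_induct)
    case less
    have "x t k - y t k = 0" if "0 \<le> t" for t
    proof (rule homogeneous_linear_ode_zero[OF _ _ that])
      fix t :: real assume t: "0 \<le> t"
      have "f (x t) k = f (y t) k"
        using less t by (intro triangular) auto
      then show "((\<lambda>t. x t k - y t k) has_vector_derivative - c k *\<^sub>R (x t k - y t k)) (at t within {0..})"
        using assms(1,2) t unfolding solves_def
        by (intro has_vector_derivative_eq_rhs[OF has_vector_derivative_diff]) (auto simp: algebra_simps)
    qed (use assms in simp)
    then show ?case by simp
  qed
  then show ?thesis using assms(4) by auto
qed

text \<open>Picard iteration through the Duhamel formula. It becomes stationary in each coordinate: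
  iterate \<open>m\<close> is already final in all degrees below \<open>m\<close>, so the zero start
  is a mere placeholder.\<close>

primrec picard :: "('k \<Rightarrow> 'a) \<Rightarrow> nat \<Rightarrow> real \<Rightarrow> 'k \<Rightarrow> 'a" where
  "picard x\<^sub>0 0 = (\<lambda>t k. 0)"
| "picard x\<^sub>0 (Suc m) = (\<lambda>t k. exp (- c k * t) *\<^sub>R
     (x\<^sub>0 k + integral {0..t} (\<lambda>s. exp (c k * s) *\<^sub>R f (picard x\<^sub>0 m s) k)))"

lemma continuous_on_f:
  "continuous_on {0..} x \<Longrightarrow> continuous_on {0..} (\<lambda>s. f (x s) k)"
  by (rule continuous_on_compose2[OF cont]) auto

lemma continuous_on_picard: "continuous_on {0..} (picard x\<^sub>0 m)"
proof (induction m)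
  case (Suc m)
  have "continuous_on {0..} (\<lambda>t. picard x\<^sub>0 (Suc m) t k)" for k
    using duhamel_has_vector_derivative[OF continuous_on_f[OF Suc]]
    by (intro continuous_on_vector_derivative) auto
  then show ?case by (rule continuous_on_coordinatewise_then_product)
qed simp

text \<open>Each further iterate settles one more degree: coordinates that enter \<open>f\<close> at
  \<open>k\<close> have degree below \<open>deg k\<close>, hence are settled one iterate
  earlier.\<close>

lemma picard_stable:
  "deg k < m \<Longrightarrow> deg k < n \<Longrightarrow> picard x\<^sub>0 m t k = picard x\<^sub>0 n t k"
proof (induction m arbitrary: n t k)
  case (Suc m)
  then obtain n' where n: "n = Suc n'" by (cases n) auto
  have "f (picard x\<^sub>0 m s) k = f (picard x\<^sub>0 n' s) k" for s
    by (intro triangular Suc.IH) (use Suc.prems n in linarith)+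
  then show ?case by (simp add: n)
qed simp

lemma solution_exists:
  obtains x where "solves x" and "x 0 = x\<^sub>0"
proof
  \<comment> \<open>Diagonal choice: \<open>Suc (deg k)\<close> is the first iterate that is final
    at \<open>k\<close>. Its Duhamel integrand involves the iterate \<open>deg k\<close>, which
    agrees with \<open>x\<close> in all degrees below \<open>deg k\<close>.\<close>
  define x where "x = (\<lambda>t k. picard x\<^sub>0 (Suc (deg k)) t k)"
  have x: "f (x t) k = f (picard x\<^sub>0 (deg k) t) k" for t k
    unfolding x_def by (rule triangular) (auto intro: picard_stable simp del: picard.simps)
  show "solves x"
    unfolding solves_def x
    using duhamel_has_vector_derivative[OF continuous_on_f[OF continuous_on_picard]]
    by (auto simp: x_def)
  show "x 0 = x\<^sub>0" by (auto simp: x_def)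
qed

text \<open>Induction on the degree must carry boundedness and decay along with convergence, since
  \<open>decay\<close> consumes both to control the forcing in the next degree. Coordinates with
  \<open>0 < c k\<close> are damped; those with \<open>c k = 0\<close> merely integrate the
  forcing.\<close>

lemma solution_convergent:
  assumes "solves x" and c: "\<And>k. 0 \<le> c k"
    and decay: "\<And>k y. (\<And>l. deg l < deg k \<Longrightarrow> bounded_forward (\<lambda>t. y t l)) \<Longrightarrow>
      (\<And>l. deg l < deg k \<Longrightarrow> 0 < c l \<Longrightarrow> exp_decay (\<lambda>t. y t l)) \<Longrightarrow> exp_decay (\<lambda>t. f (y t) k)"
  obtains L where "(x \<longlongrightarrow> L) at_top" and "\<And>k. 0 < c k \<Longrightarrow> L k = 0"
proof -
  have *: "bounded_forward (\<lambda>t. x t k) \<and> (0 < c k \<longrightarrow> exp_decay (\<lambda>t. x t k)) \<and>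
      (\<exists>l. ((\<lambda>t. x t k) \<longlongrightarrow> l) at_top \<and> (0 < c k \<longrightarrow> l = 0))" for k
  proof (induction "deg k" arbitrary: k rule: less_induct)
    case less
    have f: "exp_decay (\<lambda>t. f (x t) k)"
      using less by (intro decay) auto
    have x: "((\<lambda>s. x s k) has_vector_derivative - c k *\<^sub>R x t k + f (x t) k) (at t within {0..})"
      if "0 \<le> t" for t
      using assms(1) that by (auto simp: solves_def)
    show ?case
    proof (cases "0 < c k")
      case True
      have "exp_decay (\<lambda>t. x t k)"
        by (rule linear_ode_exp_decay[OF x True f])
      then show ?thesis
        using exp_decay_imp_bounded_forward exp_decay_imp_tendsto_zero by blast
    next
      case False
      then have "c k = 0" using c[of k] by simp
      then obtain l where "((\<lambda>t. x t k) \<longlongrightarrow> l) at_top" "bounded_forward (\<lambda>t. x t k)"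
        using exp_decay_derivative_imp_convergent[of "\<lambda>t. x t k", OF _ f] x by auto
      then show ?thesis using False by blast
    qed
  qed
  then obtain L where L: "\<And>k. ((\<lambda>t. x t k) \<longlongrightarrow> L k) at_top \<and> (0 < c k \<longrightarrow> L k = 0)"
    by metis
  show ?thesis
    by (rule that[of L]) (use L in \<open>auto intro: tendsto_coordinatewise\<close>)
qed

end

section \<open>The Poisson bracket with the quadratic part \<open>H2\<close>\<close>

lemma mdeg_add: "mdeg (a + b) = mdeg a + mdeg b"
  by (simp add: mdeg_def sum.distrib)

lemma mdeg_axis [simp]: "mdeg (axis j 1, 0) = 1" "mdeg (0, axis j 1) = 1"
  by (simp_all add: mdeg_def axis_def)

lemma mfps_mult_add_right: "mfps_mult F (\<lambda>l. G l + G' l) k = mfps_mult F G k + mfps_mult F G' k"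
  by (simp add: mfps_mult_def algebra_simps sum.distrib case_prod_unfold)

lemma poisson_add_right: "poisson F (\<lambda>l. G l + G' l) k = poisson F G k + poisson F G' k"
proof -
  have "deriv_z j (\<lambda>l. G l + G' l) = (\<lambda>l. deriv_z j G l + deriv_z j G' l)"
    "deriv_zbar j (\<lambda>l. G l + G' l) = (\<lambda>l. deriv_zbar j G l + deriv_zbar j G' l)" for j
    by (auto simp: deriv_z_def deriv_zbar_def algebra_simps)
  then show ?thesis
    by (simp add: poisson_def mfps_mult_add_right algebra_simps sum.distrib sum_subtractf)
qed

text \<open>Only the splitting \<open>(a, u)\<close> contributes. This is applied to the first
  derivatives of \<open>H2\<close>, which are monomials.\<close>

lemma mfps_mult_monomial:
  "mfps_mult F (\<lambda>b. if b = u then w else 0) (a + u) = F a * w"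
proof -
  have "mfps_mult F (\<lambda>b. if b = u then w else 0) (a + u) =
      (\<Sum>p\<in>{(a', b). a' + b = a + u}. if p = (a, u) then F a * w else 0)"
    unfolding mfps_mult_def
  proof (rule sum.cong)
    fix p assume "p \<in> {(a', b). a' + b = a + u}"
    then show "(case p of (a', b) \<Rightarrow> F a' * (if b = u then w else 0)) =
        (if p = (a, u) then F a * w else 0)"
      by (cases "snd p = u") (auto simp: case_prod_unfold prod_eq_iff[of p])
  qed simp
  then show ?thesis
    using finite_mindex_splittings[of "a + u"] by (simp add: sum.delta)
qed

lemma mfps_mult_monomial_eq_0:
  assumes "\<And>a. k \<noteq> a + u"
  shows "mfps_mult F (\<lambda>b. if b = u then w else 0) k = 0"
  unfolding mfps_mult_def case_prod_unfold
proof (rule sum.neutral, rule ballI)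
  fix p assume "p \<in> {p. fst p + snd p = k}"
  then have "snd p \<noteq> u" using assms[of "fst p"] by auto
  then show "F (fst p) * (if snd p = u then w else 0) = 0" by simp
qed

text \<open>Decides which summand of \<open>H2\<close> survives a partial derivative with index
  \<open>j\<close>: the one with \<open>i = j\<close>, leaving the conjugate variable.\<close>

lemma add_axis_eq_diagonal_iff:
  fixes b :: "'n::finite mindex"
  shows "b + (axis j 1, 0) = (axis i 1, axis i 1) \<longleftrightarrow> i = j \<and> b = (0, axis j 1)"
    and "b + (0, axis j 1) = (axis i 1, axis i 1) \<longleftrightarrow> i = j \<and> b = (axis j 1, 0)"
proof -
  have *: "v + axis j 1 = axis i 1 \<longleftrightarrow> i = j \<and> v = 0" for v :: "nat ^ 'n"
  proof
    assume eq: "v + axis j 1 = axis i 1"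
    from arg_cong[OF eq, of "\<lambda>w. w $ j"] have "i = j"
      by (auto simp: axis_def split: if_splits)
    then show "i = j \<and> v = 0" using eq by simp
  qed auto
  show "b + (axis j 1, 0) = (axis i 1, axis i 1) \<longleftrightarrow> i = j \<and> b = (0, axis j 1)"
    "b + (0, axis j 1) = (axis i 1, axis i 1) \<longleftrightarrow> i = j \<and> b = (axis j 1, 0)"
    using * by (cases b; auto)+
qed

lemma deriv_H2:
  fixes \<omega> :: "real ^ 'n::finite"
  shows "deriv_z j (H2 \<omega>) = (\<lambda>b. if b = (0, axis j 1) then complex_of_real (\<omega> $ j) else 0)"
    and "deriv_zbar j (H2 \<omega>) = (\<lambda>b. if b = (axis j 1, 0) then complex_of_real (\<omega> $ j) else 0)"
proof -
  have "H2 \<omega> (b + (axis j 1, 0)) = (if b = (0, axis j 1) then complex_of_real (\<omega> $ j) else 0)"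
    "H2 \<omega> (b + (0, axis j 1)) = (if b = (axis j 1, 0) then complex_of_real (\<omega> $ j) else 0)" for b
    unfolding H2_def add_axis_eq_diagonal_iff by simp_all
  then show "deriv_z j (H2 \<omega>) = (\<lambda>b. if b = (0, axis j 1) then complex_of_real (\<omega> $ j) else 0)"
    "deriv_zbar j (H2 \<omega>) = (\<lambda>b. if b = (axis j 1, 0) then complex_of_real (\<omega> $ j) else 0)"
    by (auto simp: deriv_z_def deriv_zbar_def fun_eq_iff)
qed

lemma obtain_minus_axis:
  fixes v :: "nat ^ 'n::finite"
  assumes "v $ j \<noteq> 0"
  obtains w where "v = w + axis j 1"
  by (rule that[of "\<chi> i. if i = j then v $ i - 1 else v $ i"])
     (use assms in \<open>auto simp: vec_eq_iff axis_def\<close>)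

text \<open>Differentiating in a variable and multiplying by the same variable is an Euler operator;
  it multiplies each coefficient by the exponent of that variable.\<close>

lemma mfps_mult_deriv_H2:
  fixes \<omega> :: "real ^ 'n::finite" and k :: "'n mindex"
  shows "mfps_mult (deriv_zbar j F) (deriv_z j (H2 \<omega>)) k = of_nat (snd k $ j) * of_real (\<omega> $ j) * F k"
    and "mfps_mult (deriv_z j F) (deriv_zbar j (H2 \<omega>)) k = of_nat (fst k $ j) * of_real (\<omega> $ j) * F k"
proof -
  show "mfps_mult (deriv_zbar j F) (deriv_z j (H2 \<omega>)) k = of_nat (snd k $ j) * of_real (\<omega> $ j) * F k"
  proof (cases "snd k $ j = 0")
    \<comment> \<open>The variable does not occur in the monomial of index \<open>k\<close>, so no
      splitting contributes and the exponent on the right is zero.\<close>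
    case True
    then have "k \<noteq> a + (0, axis j 1)" for a by auto
    then show ?thesis using True by (simp add: deriv_H2 mfps_mult_monomial_eq_0)
  next
    case False
    then obtain w where "snd k = w + axis j 1" by (rule obtain_minus_axis)
    then have "k = (fst k, w) + (0, axis j 1)" by (simp add: prod_eq_iff)
    then obtain a where "k = a + (0, axis j 1)" by blast
    then show ?thesis
      by (simp add: deriv_H2 mfps_mult_monomial deriv_zbar_def)
  qed
  show "mfps_mult (deriv_z j F) (deriv_zbar j (H2 \<omega>)) k = of_nat (fst k $ j) * of_real (\<omega> $ j) * F k"
  proof (cases "fst k $ j = 0")
    case True
    then have "k \<noteq> a + (axis j 1, 0)" for a by auto
    then show ?thesis using True by (simp add: deriv_H2 mfps_mult_monomial_eq_0)
  next
    case False
    then obtain w where "fst k = w + axis j 1" by (rule obtain_minus_axis)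
    then have "k = (w, snd k) + (axis j 1, 0)" by (simp add: prod_eq_iff)
    then obtain a where "k = a + (axis j 1, 0)" by blast
    then show ?thesis
      by (simp add: deriv_H2 mfps_mult_monomial deriv_z_def)
  qed
qed

text \<open>The Euler operators combine to the sum of \<open>\<omega> $ j\<close> times the exponent
  differences: monomials are eigenvectors of the bracket with \<open>H2\<close>.\<close>

lemma poisson_H2: "poisson F (H2 \<omega>) k = \<i> * of_real (freq \<omega> (mdiff k)) * F k"
  by (simp add: poisson_def mfps_mult_deriv_H2 freq_def mdiff_def inner_vec_def
      sum_distrib_left sum_distrib_right algebra_simps)

section \<open>The quadratic part of the vector field\<close>

text \<open>Each of the two derivatives lowers a degree by one. If both factors have degree at least
  3, each has degree at most \<open>mdeg k - 1\<close>; this is the source of triangularity.\<close>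

lemma mdeg_splitting:
  assumes "p \<in> {(a, b). a + b = k}"
  shows "mdeg (fst p + (0, axis j 1)) + mdeg (snd p + (axis j 1, 0)) = mdeg k + 2"
    and "mdeg (fst p + (axis j 1, 0)) + mdeg (snd p + (0, axis j 1)) = mdeg k + 2"
proof -
  have "k = fst p + snd p" using assms by auto
  then show "mdeg (fst p + (0, axis j 1)) + mdeg (snd p + (axis j 1, 0)) = mdeg k + 2"
    "mdeg (fst p + (axis j 1, 0)) + mdeg (snd p + (0, axis j 1)) = mdeg k + 2"
    by (simp_all only: mdeg_add mdeg_axis)
qed

text \<open>Truncating makes the bracket triangular in the degree on all power series, not only
  on \<^const>\<open>F_diamond\<close>.\<close>

definition cubic_part :: "'n::finite mfps \<Rightarrow> 'n mfps" where
  "cubic_part H k = (if 3 \<le> mdeg k then H k else 0)"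

lemma F_diamond_low_degree: "H \<in> F_diamond \<Longrightarrow> mdeg k < 3 \<Longrightarrow> H k = 0"
  unfolding F_diamond_def using not_le by blast

lemma F_diamondI: "(\<And>k. mdeg k < 3 \<Longrightarrow> H k = 0) \<Longrightarrow> H \<in> F_diamond"
  unfolding F_diamond_def using not_le by blast

lemma cubic_part_F_diamond: "H \<in> F_diamond \<Longrightarrow> cubic_part H = H"
  by (rule ext) (simp add: cubic_part_def F_diamond_low_degree)

text \<open>\<open>xi\<close> truncates below degree 3 by its definition, so the explicit truncation
  is put on the second factor.\<close>

definition normalizing_bracket :: "real ^ 'n::finite \<Rightarrow> 'n mfps \<Rightarrow> 'n mfps" where
  "normalizing_bracket \<omega> H = poisson (xi \<omega> H) (cubic_part H)"

lemma normalizing_bracket_eq: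
  "normalizing_bracket \<omega> H k = \<i> * (\<Sum>j\<in>UNIV.
     (\<Sum>(a, b)\<in>{(a, b). a + b = k}. of_nat (Suc (snd a $ j) * Suc (fst b $ j)) *
        (xi \<omega> H (a + (0, axis j 1)) * cubic_part H (b + (axis j 1, 0)))) -
     (\<Sum>(a, b)\<in>{(a, b). a + b = k}. of_nat (Suc (fst a $ j) * Suc (snd b $ j)) *
        (xi \<omega> H (a + (axis j 1, 0)) * cubic_part H (b + (0, axis j 1)))))"
  unfolding normalizing_bracket_def poisson_def mfps_mult_def deriv_z_def deriv_zbar_def
  by (simp only: of_nat_mult mult_ac)

lemma normalizing_bracket_cong:
  assumes "\<And>p q. mdeg p + mdeg q = mdeg k + 2 \<Longrightarrow>
    xi \<omega> H p * cubic_part H q = xi \<omega> H' p * cubic_part H' q"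
  shows "normalizing_bracket \<omega> H k = normalizing_bracket \<omega> H' k"
  unfolding normalizing_bracket_eq case_prod_unfold
  by (intro arg_cong[where f = "times c" for c] arg_cong2[where f = minus] sum.cong refl)
     (rule assms, rule mdeg_splitting, simp add: case_prod_unfold)+

text \<open>If a factor has degree below 3, truncation kills both products; otherwise both degrees
  are below \<open>mdeg k\<close>.\<close>

lemma xi_cubic_part_triangular:
  assumes "mdeg p + mdeg q = mdeg k + 2"
    and "\<And>l. mdeg l < mdeg k \<Longrightarrow> H l = H' l"
  shows "xi \<omega> H p * cubic_part H q = xi \<omega> H' p * cubic_part H' q"
  using assms by (auto simp: xi_def cubic_part_def)

text \<open>Each coefficient is a polynomial in finitely many coordinates.\<close>

lemma continuous_on_normalizing_bracket:
  "continuous_on UNIV (\<lambda>H. normalizing_bracket \<omega> H k)"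
proof -
  have "continuous_on UNIV (\<lambda>H. xi \<omega> H p)" "continuous_on UNIV (\<lambda>H. cubic_part H p)" for p
    by (cases "3 \<le> mdeg p"; simp add: xi_def cubic_part_def continuous_intros)+
  then show ?thesis
    unfolding normalizing_bracket_eq case_prod_unfold by (intro continuous_intros)
qed

text \<open>Every product in the bracket has a factor from \<^term>\<open>xi \<omega> H\<close>, and xi kills exactly the
  frequency-zero coefficients, so no product of two non-decaying coefficients occurs.\<close>

lemma normalizing_bracket_exp_decay:
  fixes H :: "real \<Rightarrow> 'n::finite mfps"
  assumes bd: "\<And>l. mdeg l < mdeg k \<Longrightarrow> bounded_forward (\<lambda>t. H t l)"
    and decay: "\<And>l. mdeg l < mdeg k \<Longrightarrow> freq \<omega> (mdiff l) \<noteq> 0 \<Longrightarrow> exp_decay (\<lambda>t. H t l)"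
  shows "exp_decay (\<lambda>t. normalizing_bracket \<omega> (H t) k)"
proof -
  have *: "exp_decay (\<lambda>t. xi \<omega> (H t) p * cubic_part (H t) q)"
    if "mdeg p + mdeg q = mdeg k + 2" for p q
  proof (cases "3 \<le> mdeg p \<and> 3 \<le> mdeg q \<and> freq \<omega> (mdiff p) \<noteq> 0")
    case True
    then have "exp_decay (\<lambda>t. H t p * H t q)"
      by (intro exp_decay_mult_bounded decay bd) (use that in auto)
    then have "exp_decay (\<lambda>t. (- \<i> * of_real (sgn (freq \<omega> (mdiff p)))) * (H t p * H t q))"
      by (rule exp_decay_cmult)
    then show ?thesis using True by (simp add: xi_def cubic_part_def mult.assoc)
  next
    case False
    then have "xi \<omega> (H t) p * cubic_part (H t) q = 0" for t
      by (auto simp: xi_def cubic_part_def)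
    then show ?thesis by (simp only: exp_decay_zero)
  qed
  show ?thesis
    unfolding normalizing_bracket_eq case_prod_unfold
    by (intro exp_decay_cmult exp_decay_sum exp_decay_diff *)
       (rule mdeg_splitting, simp add: case_prod_unfold)+
qed

text \<open>Here the degrees of the two factors sum to less than 5, so one of them is below 3 and
  every product vanishes, as it does for the zero series.\<close>

lemma normalizing_bracket_low_degree:
  assumes "mdeg k < 3"
  shows "normalizing_bracket \<omega> H k = 0"
proof -
  have "normalizing_bracket \<omega> H k = normalizing_bracket \<omega> (\<lambda>_. 0) k"
    by (rule normalizing_bracket_cong) (use assms in \<open>auto simp: xi_def cubic_part_def\<close>)
  also have "\<dots> = 0" by (simp add: normalizing_bracket_eq cubic_part_def)
  finally show ?thesis .
qed

section \<open>The flow as a triangular system\<close>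

text \<open>The eigenvalue of the bracket with \<open>H2\<close> meets the sign supplied by
  \<open>xi\<close>: the imaginary units cancel and frequency times sign is the absolute value,
  hence damping.\<close>

lemma vector_field_eq:
  assumes "H \<in> F_diamond"
  shows "- poisson (xi \<omega> H) (\<lambda>l. H2 \<omega> l + H l) k =
    - \<bar>freq \<omega> (mdiff k)\<bar> *\<^sub>R H k + - normalizing_bracket \<omega> H k"
proof -
  \<comment> \<open>The formula holds below degree 3 as well, where both sides are zero.\<close>
  have "xi \<omega> H k = - \<i> * of_real (sgn (freq \<omega> (mdiff k))) * H k"
    using F_diamond_low_degree[OF assms, of k] by (simp add: xi_def)
  then have "poisson (xi \<omega> H) (H2 \<omega>) k = of_real (freq \<omega> (mdiff k) * sgn (freq \<omega> (mdiff k))) * H k"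
    by (simp add: poisson_H2 mult_ac)
  then show ?thesis
    unfolding poisson_add_right normalizing_bracket_def cubic_part_F_diamond[OF assms]
    by (simp add: abs_sgn scaleR_conv_of_real)
qed

interpretation normalization_flow: triangular_ode mdeg "\<lambda>k. \<bar>freq \<omega> (mdiff k)\<bar>"
  "\<lambda>H k. - normalizing_bracket \<omega> H k" for \<omega> :: "real ^ 'n::finite"
  by unfold_locales
     (auto intro!: normalizing_bracket_cong xi_cubic_part_triangular continuous_intros
       continuous_on_normalizing_bracket)

text \<open>Membership in \<open>F_diamond\<close> propagates: below degree 3 the quadratic part
  vanishes, so the coefficient solves a homogeneous equation with zero initial value.\<close>

lemma is_solution_iff:
  fixes \<omega> :: "real ^ 'n::finite"
  assumes "Hhat \<in> F_diamond"
  shows "is_solution \<omega> Hhat H \<longleftrightarrow> H 0 = Hhat \<and> normalization_flow.solves \<omega> H"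
proof
  assume sol: "is_solution \<omega> Hhat H"
  have "((\<lambda>s. H s k) has_vector_derivative
      - \<bar>freq \<omega> (mdiff k)\<bar> *\<^sub>R H t k + - normalizing_bracket \<omega> (H t) k) (at t within {0..})"
    if "0 \<le> t" for t k
  proof -
    have "H t \<in> F_diamond" using sol that by (simp add: is_solution_def)
    from vector_field_eq[OF this, of \<omega> k] show ?thesis
      using sol that unfolding is_solution_def by metis
  qed
  with sol show "H 0 = Hhat \<and> normalization_flow.solves \<omega> H"
    unfolding is_solution_def normalization_flow.solves_def by blast
next
  assume H: "H 0 = Hhat \<and> normalization_flow.solves \<omega> H"
  have "H t k = 0" if "0 \<le> t" "mdeg k < 3" for t k
  proof (rule homogeneous_linear_ode_zero[OF _ _ that(1)])
    show "((\<lambda>t. H t k) has_vector_derivative - \<bar>freq \<omega> (mdiff k)\<bar> *\<^sub>R H t k) (at t within {0..})"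
      if "0 \<le> t" for t
      using normalization_flow.solvesD[OF conjunct2[OF H] that, of k]
      by (simp add: normalizing_bracket_low_degree[OF \<open>mdeg k < 3\<close>])
    show "H 0 k = 0" using H F_diamond_low_degree[OF assms that(2)] by simp
  qed
  then have F: "H t \<in> F_diamond" if "0 \<le> t" for t
    using that by (auto intro: F_diamondI)
  have "((\<lambda>s. H s k) has_vector_derivative - poisson (xi \<omega> (H t)) (\<lambda>l. H2 \<omega> l + H t l) k)
      (at t within {0..})" if "0 \<le> t" for t k
    unfolding vector_field_eq[OF F[OF that]]
    by (rule normalization_flow.solvesD[OF conjunct2[OF H] that])
  with H F show "is_solution \<omega> Hhat H"
    unfolding is_solution_def by blast
qed

text \<open>Any two solutions agree at nonnegative times, so the description in \<open>flow\<close>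
  picks out a single value.\<close>

lemma flow_eq:
  assumes "Hhat \<in> F_diamond" and H: "is_solution \<omega> Hhat H" and "0 \<le> \<delta>"
  shows "flow \<omega> \<delta> Hhat = H \<delta>"
  unfolding flow_def
proof (rule the_equality)
  fix X assume "\<exists>H. is_solution \<omega> Hhat H \<and> X = H \<delta>"
  then obtain H' where "is_solution \<omega> Hhat H'" "X = H' \<delta>" by blast
  then show "X = H \<delta>"
    using normalization_flow.solves_unique[of \<omega> H' H \<delta>] H assms(3)
    by (simp add: is_solution_iff[OF assms(1)])
qed (use H in blast)

theorem corollary3p1:
  fixes \<omega> :: "real ^ 'n::finite" and Hhat :: "'n mfps"
  assumes "nonresonant \<omega>"
    and "Hhat \<in> F_diamond"
  shows "\<exists>L\<in>N_diamond. ((\<lambda>\<delta>. flow \<omega> \<delta> Hhat) \<longlongrightarrow> L) at_top"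
proof -
  obtain H where solves: "normalization_flow.solves \<omega> H" and H0: "H 0 = Hhat"
    by (rule normalization_flow.solution_exists)
  then have sol: "is_solution \<omega> Hhat H"
    by (simp add: is_solution_iff[OF assms(2)])
  have decay: "exp_decay (\<lambda>t. - normalizing_bracket \<omega> (y t) k)"
    if "\<And>l. mdeg l < mdeg k \<Longrightarrow> bounded_forward (\<lambda>t. y t l)"
      "\<And>l. mdeg l < mdeg k \<Longrightarrow> 0 < \<bar>freq \<omega> (mdiff l)\<bar> \<Longrightarrow> exp_decay (\<lambda>t. y t l)" for k y
    using exp_decay_cmult[OF normalizing_bracket_exp_decay[of k y \<omega>], of "-1"] that by simp
  obtain L where L: "(H \<longlongrightarrow> L) at_top" and L0: "\<And>k. 0 < \<bar>freq \<omega> (mdiff k)\<bar> \<Longrightarrow> L k = 0"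
    using normalization_flow.solution_convergent[OF solves _ decay] by auto
  \<comment> \<open>\<open>flow\<close> is identified with \<open>H\<close> for nonnegative times,
    which suffices for a limit at infinity.\<close>
  have lim: "((\<lambda>\<delta>. flow \<omega> \<delta> Hhat) \<longlongrightarrow> L) at_top"
    by (rule Lim_transform_eventually[OF L])
       (auto intro!: eventually_mono[OF eventually_ge_at_top[of 0]] simp: flow_eq[OF assms(2) sol])
  \<comment> \<open>Coefficients below degree 3 vanish along the solution, hence in the
    limit.\<close>
  have "L k = 0" if "mdeg k < 3" for k
  proof (rule tendsto_unique)
    show "((\<lambda>t. H t k) \<longlongrightarrow> L k) at_top"
      by (rule continuous_on_tendsto_compose[OF continuous_on_product_coordinates L]) auto
    have "\<forall>\<^sub>F t in at_top. H t k = 0"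
      by (rule eventually_mono[OF eventually_ge_at_top[of 0]])
         (use sol that in \<open>simp add: is_solution_def F_diamond_low_degree\<close>)
    then show "((\<lambda>t. H t k) \<longlongrightarrow> 0) at_top" by (rule tendsto_eventually)
  qed simp
  then have "L \<in> F_diamond" by (rule F_diamondI)
  \<comment> \<open>A nonzero limit coefficient must have frequency zero, and nonresonance turns
    this into \<open>mdiff k = 0\<close>.\<close>
  moreover have "mdiff k = 0" if "L k \<noteq> 0" for k
    using L0[of k] that assms(1) unfolding nonresonant_def by auto
  ultimately show ?thesis using lim by (auto simp: N_diamond_def)
qed

end
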